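(* Let $G$ be a Hausdorff topological group and let $X$ be a $G$-pre-ambit. Then there is a universal strong extension $\psi_X:S(X)\to X$, and any two universal strong extensions of $X$ are isomorphic over $X$.
   Context: A (right) $G$-flow is a compact Hausdorff space with a continuous right $G$-action; a $G$-map is a continuous equivariant map. A pre-ambit is a $G$-flow containing a point with dense orbit. For a pre-ambit $X$, its ambit set is $\mathcal{A}(X)=\{x\in X:\overline{xG}=X\}$. For pre-ambits $X,Y$, a $G$-map $\phi:X\to Y$ is strong if for every $x\in X$: $x\in\mathcal{A}(X)\iff\phi(x)\in\mathcal{A}(Y)$. A strong extension of the pre-ambit $X$ is a strong map $\psi:Y\to X$ from a pre-ambit $Y$. A strong extension $\psi_0:Y_0\to X$ is universal if for every strong extension $\psi_1:Y_1\to X$ there is a strong map $\phi:Y_0\to Y_1$ with $\psi_1\circ\phi=\psi_0$. Two strong extensions $\psi_i:Y_i\to X$ ($i<2$) are isomorphic over $X$ if there is an isomorphism of flows $\phi:Y_0\to Y_1$ with $\psi_1\circ\phi=\psi_0$. *)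

theory Defs
  imports "HOL-Analysis.Analysis"
begin

(* The acting group is a type of class topological_group_add: a topological group, not assumed
   commutative, written additively. So the flow law x(gh) = (xg)h reads act x (g + h) = act (act x g) h. *)

definition g_flow :: "'x topology \<Rightarrow> ('x \<Rightarrow> 'g::topological_group_add \<Rightarrow> 'x) \<Rightarrow> bool" where
  "g_flow X act \<longleftrightarrow>
     compact_space X \<and> Hausdorff_space X \<and>
     continuous_map (prod_topology X (euclidean :: 'g topology)) X (\<lambda>(x, g). act x g) \<and>
     (\<forall>x\<in>topspace X. act x 0 = x) \<and>
     (\<forall>x\<in>topspace X. \<forall>g h. act x (g + h) = act (act x g) h)"

definition g_map ::
  "'x topology \<Rightarrow> ('x \<Rightarrow> 'g::topological_group_add \<Rightarrow> 'x) \<Rightarrow>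
   'y topology \<Rightarrow> ('y \<Rightarrow> 'g \<Rightarrow> 'y) \<Rightarrow> ('x \<Rightarrow> 'y) \<Rightarrow> bool" where
  "g_map X actX Y actY f \<longleftrightarrow>
     continuous_map X Y f \<and> (\<forall>x\<in>topspace X. \<forall>g. f (actX x g) = actY (f x) g)"

definition ambit_set :: "'x topology \<Rightarrow> ('x \<Rightarrow> 'g::topological_group_add \<Rightarrow> 'x) \<Rightarrow> 'x set" where
  "ambit_set X act = {x \<in> topspace X. X closure_of range (act x) = topspace X}"

definition pre_ambit :: "'x topology \<Rightarrow> ('x \<Rightarrow> 'g::topological_group_add \<Rightarrow> 'x) \<Rightarrow> bool" where
  "pre_ambit X act \<longleftrightarrow> g_flow X act \<and> ambit_set X act \<noteq> {}"

definition strong_map ::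
  "'x topology \<Rightarrow> ('x \<Rightarrow> 'g::topological_group_add \<Rightarrow> 'x) \<Rightarrow>
   'y topology \<Rightarrow> ('y \<Rightarrow> 'g \<Rightarrow> 'y) \<Rightarrow> ('x \<Rightarrow> 'y) \<Rightarrow> bool" where
  "strong_map X actX Y actY f \<longleftrightarrow>
     g_map X actX Y actY f \<and>
     (\<forall>x\<in>topspace X. x \<in> ambit_set X actX \<longleftrightarrow> f x \<in> ambit_set Y actY)"

definition strong_extension ::
  "'x topology \<Rightarrow> ('x \<Rightarrow> 'g::topological_group_add \<Rightarrow> 'x) \<Rightarrow>
   'y topology \<Rightarrow> ('y \<Rightarrow> 'g \<Rightarrow> 'y) \<Rightarrow> ('y \<Rightarrow> 'x) \<Rightarrow> bool" where
  "strong_extension X actX Y actY \<psi> \<longleftrightarrow>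
     pre_ambit Y actY \<and> strong_map Y actY X actX \<psi>"

(* HOL cannot quantify over types inside a formula, so the type 'u of the points of the competing
   extensions Y1 is a parameter. For 'u = 'g set set no strong extension is missed up to isomorphism:
   if y0 has dense orbit in a flow Y, then sending y to {A. y in the closure of y0 A} is an
   injection of Y into 'g set set. *)
definition universal_strong_extension ::
  "'u itself \<Rightarrow> 'x topology \<Rightarrow> ('x \<Rightarrow> 'g::topological_group_add \<Rightarrow> 'x) \<Rightarrow>
   'y topology \<Rightarrow> ('y \<Rightarrow> 'g \<Rightarrow> 'y) \<Rightarrow> ('y \<Rightarrow> 'x) \<Rightarrow> bool" where
  "universal_strong_extension (_ :: 'u itself) X actX Y0 actY0 \<psi>0 \<longleftrightarrow>
     strong_extension X actX Y0 actY0 \<psi>0 \<and>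
     (\<forall>(Y1 :: 'u topology) actY1 \<psi>1. strong_extension X actX Y1 actY1 \<psi>1 \<longrightarrow>
        (\<exists>\<phi>. strong_map Y0 actY0 Y1 actY1 \<phi> \<and> (\<forall>y\<in>topspace Y0. \<psi>1 (\<phi> y) = \<psi>0 y)))"

definition isomorphic_over ::
  "'y topology \<Rightarrow> ('y \<Rightarrow> 'g::topological_group_add \<Rightarrow> 'y) \<Rightarrow> ('y \<Rightarrow> 'x) \<Rightarrow>
   'z topology \<Rightarrow> ('z \<Rightarrow> 'g \<Rightarrow> 'z) \<Rightarrow> ('z \<Rightarrow> 'x) \<Rightarrow> bool" where
  "isomorphic_over Y0 actY0 \<psi>0 Y1 actY1 \<psi>1 \<longleftrightarrow>
     (\<exists>\<phi>. g_map Y0 actY0 Y1 actY1 \<phi> \<and> homeomorphic_map Y0 Y1 \<phi> \<and>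
          (\<forall>y\<in>topspace Y0. \<psi>1 (\<phi> y) = \<psi>0 y))"

end

theory Submission
  imports Defs
begin

text \<open>
  Let \<open>E\<close> be the greatest ambit, with base point \<open>e\<close>, and map it onto \<open>X\<close> by sending \<open>e\<close> to a point
  \<open>x\<close> of the ambit set. A subflow \<open>S\<close> of \<open>E\<close> that is minimal among those mapping onto \<open>X\<close> is a strong
  extension. It is universal: in a strong extension \<open>Y\<close> any point over \<open>x\<close> has dense orbit, hence is
  the image of \<open>e\<close> under a map of \<open>E\<close> to \<open>Y\<close>, and this map can be restricted to \<open>S\<close>.

  Uniqueness reduces to the injectivity of the endomorphisms of \<open>S\<close> over \<open>X\<close>. For every \<open>p\<close> in \<open>E\<close>
  there is exactly one endomorphism \<open>L p\<close> of \<open>E\<close> with \<open>L p e = p\<close>, which makes \<open>E\<close> a semigroup with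
  product \<open>L p q\<close>. The points of \<open>S\<close> over \<open>x\<close> form a compact subsemigroup, and an idempotent \<open>u\<close> in it
  (Ellis) is a left identity of \<open>S\<close>. An endomorphism \<open>\<phi>\<close> of \<open>S\<close> over \<open>X\<close> is therefore left
  multiplication by \<open>\<phi> u\<close>, which has a left inverse by the minimality of \<open>S\<close>.
\<close>

section \<open>Zorn's lemma for intersections, and compactness along chains\<close>

text \<open>Zorn's lemma for reverse inclusion, obtained from the usual form by passing to
  complements. Chains are taken nonempty because the empty intersection is
  \<open>UNIV\<close>.\<close>

lemma Inter_Zorn_nonempty:
  assumes "\<A> \<noteq> {}" and "\<And>\<C>. \<lbrakk>\<C> \<noteq> {}; subset.chain \<A> \<C>\<rbrakk> \<Longrightarrow> \<Inter>\<C> \<in> \<A>"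
  shows "\<exists>M\<in>\<A>. \<forall>N\<in>\<A>. N \<subseteq> M \<longrightarrow> N = M"
proof -
  have "\<exists>M\<in>uminus ` \<A>. \<forall>X\<in>uminus ` \<A>. M \<subseteq> X \<longrightarrow> X = M"
  proof (rule subset_Zorn_nonempty)
    show "uminus ` \<A> \<noteq> {}"
      using assms(1) by simp
    fix \<C> assume \<C>: "\<C> \<noteq> {}" "subset.chain (uminus ` \<A>) \<C>"
    have "subset.chain \<A> (uminus ` \<C>)"
      using \<C>(2) by (fastforce simp: subset_chain_def)
    then have "\<Inter>(uminus ` \<C>) \<in> \<A>"
      using \<C>(1) assms(2) by simp
    moreover have "\<Union>\<C> = - \<Inter>(uminus ` \<C>)"
      by auto
    ultimately show "\<Union>\<C> \<in> uminus ` \<A>"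
      by blast
  qed
  then obtain M where M: "M \<in> \<A>" "\<And>N. N \<in> \<A> \<Longrightarrow> - M \<subseteq> - N \<Longrightarrow> - N = - M"
    by (smt (verit, best) imageE image_eqI)
  then show ?thesis
    by (metis compl_le_compl_iff double_complement)
qed

text \<open>A finite nonempty part of a chain has its intersection among its members, so the finite
  intersection property applies.\<close>

lemma compact_space_Inter_chain:
  assumes "compact_space X" "\<C> \<noteq> {}" "subset.chain UNIV \<C>"
    and "\<And>C. C \<in> \<C> \<Longrightarrow> closedin X C" "\<And>C. C \<in> \<C> \<Longrightarrow> C \<noteq> {}"
  shows "\<Inter>\<C> \<noteq> {}"
proof -
  have "\<Inter>\<F> \<noteq> {}" if "finite \<F>" "\<F> \<subseteq> \<C>" for \<F>
  proof (cases "\<F> = {}")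
    case False
    have "subset.chain UNIV \<F>"
      using assms(3) that(2) by (auto simp: subset_chain_def)
    then show ?thesis
      using Inter_in_chain[OF that(1) False] that(2) assms(5) by blast
  qed simp
  then show ?thesis
    using assms(1,4) by (metis compact_space_fip)
qed

section \<open>Flows, closed invariant sets and equivariant maps\<close>

definition invariant :: "('x \<Rightarrow> 'g \<Rightarrow> 'x) \<Rightarrow> 'x set \<Rightarrow> bool" where
  "invariant act C \<longleftrightarrow> (\<forall>x\<in>C. \<forall>g. act x g \<in> C)"

lemma continuous_map_act:
  assumes "g_flow X act"
  shows "continuous_map X X (\<lambda>x. act x g)"
proof -
  have "continuous_map X X ((\<lambda>(x, g). act x g) \<circ> (\<lambda>x. (x, g)))"
    by (rule continuous_map_compose[where X' = "prod_topology X (euclidean :: 'b topology)"])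
       (use assms in \<open>auto simp: g_flow_def continuous_map_pairedI\<close>)
  then show ?thesis
    by (simp add: o_def)
qed

lemma act_in_topspace: "g_flow X act \<Longrightarrow> x \<in> topspace X \<Longrightarrow> act x g \<in> topspace X"
  using continuous_map_act[of X act g] by (auto simp: continuous_map_def)

lemma invariant_topspace: "g_flow X act \<Longrightarrow> invariant act (topspace X)"
  by (simp add: invariant_def act_in_topspace)

text \<open>The orbit closure is the least closed invariant set containing \<open>x\<close>. This
  form suits flow maps, whose images and preimages of closed invariant sets are again closed and
  invariant.\<close>

lemma ambit_set_iff:
  assumes "g_flow X act"
  shows "x \<in> ambit_set X act \<longleftrightarrow>
    x \<in> topspace X \<and> (\<forall>C. closedin X C \<and> invariant act C \<and> x \<in> C \<longrightarrow> C = topspace X)"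
proof (cases "x \<in> topspace X")
  case True
  let ?O = "range (act x)"
  have orbit: "?O \<subseteq> topspace X"
    using act_in_topspace[OF assms True] by auto
  have "act y g \<in> X closure_of ?O" if "y \<in> X closure_of ?O" for y g
  proof -
    have "act y g \<in> X closure_of ((\<lambda>y. act y g) ` ?O)"
      using continuous_map_image_closure_subset[OF continuous_map_act[OF assms]] that by blast
    moreover have "(\<lambda>y. act y g) ` ?O \<subseteq> ?O"
    proof -
      have "act (act x h) g = act x (h + g)" for h
        using assms True by (simp add: g_flow_def)
      then show ?thesis
        by auto
    qed
    ultimately show ?thesis
      using closure_of_mono by blast
  qed
  then have inv: "invariant act (X closure_of ?O)"
    by (simp add: invariant_def)
  have x: "x \<in> X closure_of ?O"
  proof -
    have "act x 0 = x"
      using assms True by (simp add: g_flow_def)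
    then show ?thesis
      using closure_of_subset[OF orbit] by (metis rangeI subsetD)
  qed
  have "X closure_of ?O \<subseteq> C" if "closedin X C" "invariant act C" "x \<in> C" for C
    using that by (intro closure_of_minimal) (auto simp: invariant_def)
  then have "X closure_of ?O = topspace X \<longleftrightarrow>
      (\<forall>C. closedin X C \<and> invariant act C \<and> x \<in> C \<longrightarrow> C = topspace X)"
    using inv x closedin_subset closedin_closure_of by (metis subset_antisym)
  then show ?thesis
    using True by (simp add: ambit_set_def)
qed (simp add: ambit_set_def)

lemma g_map_image_topspace: "g_map X actX Y actY f \<Longrightarrow> f ` topspace X \<subseteq> topspace Y"
  by (auto simp: g_map_def continuous_map_def)

lemma closedin_g_map_image:
  assumes "g_flow X actX" "g_flow Y actY" "g_map X actX Y actY f" "closedin X C"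
  shows "closedin Y (f ` C)"
  using continuous_imp_closed_map[of X Y f] assms by (simp add: g_flow_def g_map_def closed_map_def)

lemma invariant_g_map_image:
  assumes "g_map X actX Y actY f" "invariant actX C" "C \<subseteq> topspace X"
  shows "invariant actY (f ` C)"
  unfolding invariant_def
proof (intro ballI allI)
  fix y g assume "y \<in> f ` C"
  then obtain x where x: "x \<in> C" "y = f x"
    by blast
  then have "actY y g = f (actX x g)"
    using assms(1,3) by (auto simp: g_map_def)
  then show "actY y g \<in> f ` C"
    using assms(2) x(1) by (simp add: invariant_def)
qed

lemma closedin_vimage:
  "g_map X actX Y actY f \<Longrightarrow> closedin Y D \<Longrightarrow> closedin X {x \<in> topspace X. f x \<in> D}"
  unfolding g_map_def by (blast intro: closedin_continuous_map_preimage)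

lemma invariant_vimage:
  assumes "g_flow X actX" "g_map X actX Y actY f" "invariant actY D"
  shows "invariant actX {x \<in> topspace X. f x \<in> D}"
  using assms act_in_topspace[OF assms(1)] by (auto simp: g_map_def invariant_def)

lemma g_map_compose:
  assumes "g_map X actX Y actY f" "g_map Y actY Z actZ h"
  shows "g_map X actX Z actZ (\<lambda>x. h (f x))"
  using assms continuous_map_compose[of X Y f Z h] g_map_image_topspace[OF assms(1)]
  by (auto simp: g_map_def o_def)

text \<open>The points where \<open>f\<close> and \<open>h\<close> agree form a closed invariant set
  containing \<open>x\<close>. A flow map on an ambit is thus determined by its value at the base
  point.\<close>

lemma g_map_eq_on_orbit_closure:
  assumes "g_flow X actX" "g_flow Y actY" "x \<in> ambit_set X actX"
    and "g_map X actX Y actY f" "g_map X actX Y actY h" "f x = h x" "y \<in> topspace X"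
  shows "f y = h y"
proof -
  let ?C = "{y \<in> topspace X. f y = h y}"
  have "closedin X ?C"
    using assms by (intro closedin_continuous_maps_eq) (auto simp: g_map_def g_flow_def)
  moreover have "invariant actX ?C"
    using assms(4,5) act_in_topspace[OF assms(1)] by (auto simp: invariant_def g_map_def)
  ultimately have "?C = topspace X"
    using assms(3,6) ambit_set_iff[OF assms(1)] by blast
  then show ?thesis
    using assms(7) by blast
qed

lemma g_flow_subtopology:
  assumes "g_flow X act" "closedin X C" "invariant act C"
  shows "g_flow (subtopology X C) act"
proof -
  have sub: "C \<subseteq> topspace X"
    using assms(2) by (rule closedin_subset)
  have "continuous_map (prod_topology (subtopology X C) (euclidean :: 'b topology)) X (\<lambda>(x, g). act x g)"
    using assms(1) prod_topology_subtopology(1)[of X C "euclidean :: 'b topology"]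
    by (simp add: g_flow_def continuous_map_from_subtopology)
  moreover have "compact_space (subtopology X C)"
    using assms(1,2) closedin_compact_space compact_space_subtopology by (auto simp: g_flow_def)
  ultimately show ?thesis
    using assms(1,3) sub
    by (auto simp: g_flow_def invariant_def Hausdorff_space_subtopology continuous_map_in_subtopology)
qed

lemma g_map_from_subtopology:
  "g_map X actX Y actY f \<Longrightarrow> g_map (subtopology X C) actX Y actY f"
  by (auto simp: g_map_def continuous_map_from_subtopology)

lemma g_map_into_fulltopology:
  "g_map X actX (subtopology Y C) actY f \<Longrightarrow> g_map X actX Y actY f"
  using continuous_map_into_fulltopology by (auto simp: g_map_def)

text \<open>The image of \<open>X\<close> is a closed invariant set containing
  \<open>f x\<close>.\<close>

lemma ambit_surj:
  assumes "g_flow X actX" "g_flow Y actY" "g_map X actX Y actY f"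
    and "x \<in> topspace X" "f x \<in> ambit_set Y actY"
  shows "f ` topspace X = topspace Y"
  using assms closedin_g_map_image[OF assms(1-3)] invariant_g_map_image[OF assms(3)]
    invariant_topspace[OF assms(1)] ambit_set_iff[OF assms(2)] by blast

text \<open>The preimage of a closed invariant set containing \<open>f x\<close> is closed,
  invariant and contains \<open>x\<close>, so it is all of \<open>X\<close>; surjectivity carries
  this over to \<open>Y\<close>.\<close>

lemma ambit_set_image:
  assumes "g_flow X actX" "g_flow Y actY" "g_map X actX Y actY f"
    and "f ` topspace X = topspace Y" "x \<in> ambit_set X actX"
  shows "f x \<in> ambit_set Y actY"
proof -
  have x: "x \<in> topspace X"
    using assms(5) by (simp add: ambit_set_def)
  have "D = topspace Y" if "closedin Y D" "invariant actY D" "f x \<in> D" for D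
  proof -
    have "{x \<in> topspace X. f x \<in> D} = topspace X"
      using closedin_vimage[OF assms(3) that(1)] invariant_vimage[OF assms(1,3) that(2)]
        assms(5) that(3) x unfolding ambit_set_iff[OF assms(1)] by blast
    then have "f ` topspace X \<subseteq> D"
      by auto
    then show ?thesis
      using assms(4) closedin_subset[OF that(1)] by simp
  qed
  then show ?thesis
    using x assms(4) unfolding ambit_set_iff[OF assms(2)] by blast
qed

section \<open>Product flows, and copies of pre-ambits on \<open>'g set set\<close>\<close>

text \<open>The action is restricted to \<open>I\<close> because the points of a product topology
  are extensional functions.\<close>

lemma g_flow_product:
  assumes "\<And>i. i \<in> I \<Longrightarrow> g_flow (Y i) (act i)"
  shows "g_flow (product_topology Y I) (\<lambda>p g. \<lambda>i\<in>I. act i (p i) g)"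
    (is "g_flow ?P ?act")
proof -
  have "continuous_map (prod_topology ?P (euclidean :: 'c topology)) (Y i) (\<lambda>(p, g). act i (p i) g)"
    if "i \<in> I" for i
  proof -
    let ?Q = "prod_topology ?P (euclidean :: 'c topology)"
    have "continuous_map ?Q (Y i) (\<lambda>x. fst x i)"
      using continuous_map_compose[OF continuous_map_fst continuous_map_product_projection[OF that]]
      by (simp add: o_def)
    then have "continuous_map ?Q (prod_topology (Y i) (euclidean :: 'c topology)) (\<lambda>x. (fst x i, snd x))"
      by (intro continuous_map_pairedI continuous_map_snd)
    from continuous_map_compose[OF this, of "Y i" "\<lambda>(x, g). act i x g"] show ?thesis
      using assms[OF that] by (simp add: g_flow_def o_def split_def)
  qed
  then have "continuous_map (prod_topology ?P (euclidean :: 'c topology)) ?P (\<lambda>(p, g). ?act p g)"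
    by (auto simp: continuous_map_componentwise split_def)
  then show ?thesis
    using assms
    by (auto simp: g_flow_def compact_space_product_topology Hausdorff_space_product_topology PiE_iff
        extensional_def fun_eq_iff restrict_def)
qed

lemma g_map_product_projection:
  "i \<in> I \<Longrightarrow> g_map (product_topology Y I) (\<lambda>p g. \<lambda>i\<in>I. act i (p i) g) (Y i) (act i) (\<lambda>p. p i)"
  by (simp add: g_map_def)

lemma g_flow_transport:
  assumes "g_flow Y act" "homeomorphic_maps T Y h j"
  shows "g_flow T (\<lambda>z g. j (act (h z) g))"
proof -
  have h: "continuous_map T Y h" and j: "continuous_map Y T j"
    and jh: "\<And>z. z \<in> topspace T \<Longrightarrow> j (h z) = z" and hj: "\<And>y. y \<in> topspace Y \<Longrightarrow> h (j y) = y"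
    using assms(2) by (auto simp: homeomorphic_maps_def)
  have hT: "h z \<in> topspace Y" if "z \<in> topspace T" for z
    using h that by (auto simp: continuous_map_def)
  have "Y homeomorphic_space T"
    using assms(2) homeomorphic_space_def homeomorphic_space_sym by blast
  then have "compact_space T" "Hausdorff_space T"
    using assms(1) homeomorphic_compact_space homeomorphic_Hausdorff_space by (auto simp: g_flow_def)
  moreover have "continuous_map (prod_topology T (euclidean :: 'b topology)) T (\<lambda>(z, g). j (act (h z) g))"
  proof -
    have "continuous_map (prod_topology T (euclidean :: 'b topology))
        (prod_topology Y (euclidean :: 'b topology)) (\<lambda>x. (h (fst x), snd x))"
      using continuous_map_compose[OF continuous_map_fst h]
      by (intro continuous_map_pairedI continuous_map_snd) (simp add: o_def)
    then have "continuous_map (prod_topology T (euclidean :: 'b topology)) Y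
        ((\<lambda>(y, g). act y g) \<circ> (\<lambda>x. (h (fst x), snd x)))"
      using assms(1) continuous_map_compose by (auto simp: g_flow_def)
    from continuous_map_compose[OF this j] show ?thesis
      by (simp add: o_def split_def)
  qed
  ultimately show ?thesis
    using assms(1) by (simp add: g_flow_def jh hj hT act_in_topspace[OF assms(1)])
qed

text \<open>Pulling the topology back along the inverse of an injection moves a space to another
  type.\<close>

lemma homeomorphic_maps_pullback:
  assumes "inj_on j (topspace Y)"
  shows "homeomorphic_maps (pullback_topology (j ` topspace Y) (inv_into (topspace Y) j) Y) Y
    (inv_into (topspace Y) j) j"
    (is "homeomorphic_maps ?T Y ?h j")
proof -
  have hj: "?h (j y) = y" if "y \<in> topspace Y" for y
    using assms that by simp
  have top: "topspace ?T = j ` topspace Y"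
    using hj by (auto simp: topspace_pullback_topology)
  have "continuous_map ?T Y (id \<circ> ?h)"
    by (rule continuous_map_pullback) simp
  moreover have "continuous_map Y ?T j"
  proof (rule continuous_map_pullback')
    show "continuous_map Y Y (?h \<circ> j)"
      using hj by (auto intro: continuous_map_eq[OF continuous_map_id])
  qed auto
  ultimately show ?thesis
    using hj by (auto simp: homeomorphic_maps_def top)
qed

text \<open>The point \<open>y\<close> is encoded by the traces of its open neighbourhoods on the dense orbit.\<close>
lemma inj_on_orbit_traces:
  assumes "Hausdorff_space Y" "Y closure_of (range a) = topspace Y"
  shows "inj_on (\<lambda>y. {a -` U |U. openin Y U \<and> y \<in> U}) (topspace Y)"
proof (rule inj_onI, rule ccontr)
  fix y z assume y: "y \<in> topspace Y" "z \<in> topspace Y" "y \<noteq> z"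
    and eq: "{a -` U |U. openin Y U \<and> y \<in> U} = {a -` U |U. openin Y U \<and> z \<in> U}"
  obtain U V where UV: "openin Y U" "openin Y V" "y \<in> U" "z \<in> V" "disjnt U V"
    using assms(1) y unfolding Hausdorff_space_def by metis
  then have "a -` U \<in> {a -` U |U. openin Y U \<and> z \<in> U}"
    using eq by blast
  then obtain V' where V': "openin Y V'" "z \<in> V'" "a -` U = a -` V'"
    by blast
  \<comment> \<open>\<open>V'\<close> has the same trace on the orbit as \<open>U\<close>, so an
    orbit point in \<open>V \<inter> V'\<close> lies in \<open>U\<close> as well as in
    \<open>V\<close>.\<close>
  have "openin Y (V \<inter> V')" "V \<inter> V' \<noteq> {}"
    using UV V' by auto
  then have "range a \<inter> (V \<inter> V') \<noteq> {}"
    using assms(2) dense_intersects_open by metis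
  then obtain g where "a g \<in> V" "g \<in> a -` V'"
    by auto
  then show False
    using V'(3) UV(5) by (auto simp: disjnt_iff)
qed

text \<open>A dense orbit bounds the size of a flow, so every pre-ambit, whatever its type, has an
  isomorphic copy on the fixed type \<open>'g set set\<close>; \<open>h\<close> and \<open>j\<close>
  are the two mutually inverse flow maps.\<close>

lemma pre_ambit_copy:
  fixes Y :: "'y topology" and act :: "'y \<Rightarrow> 'g::topological_group_add \<Rightarrow> 'y"
  assumes "pre_ambit Y act"
  obtains T :: "'g set set topology" and actT h j where
    "g_flow T actT" "g_map T actT Y act h" "g_map Y act T actT j"
    "\<And>z. z \<in> topspace T \<Longrightarrow> j (h z) = z" "\<And>y. y \<in> topspace Y \<Longrightarrow> h (j y) = y"
proof -
  obtain y0 where flow: "g_flow Y act" and y0: "y0 \<in> ambit_set Y act"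
    using assms by (auto simp: pre_ambit_def)
  define j where "j = (\<lambda>y. {act y0 -` U |U. openin Y U \<and> y \<in> U})"
  define h where "h = inv_into (topspace Y) j"
  define T where "T = pullback_topology (j ` topspace Y) h Y"
  have hom: "homeomorphic_maps T Y h j"
    unfolding T_def h_def j_def
    using flow y0 by (intro homeomorphic_maps_pullback inj_on_orbit_traces)
      (auto simp: g_flow_def ambit_set_def)
  then have T: "continuous_map T Y h" "continuous_map Y T j"
    "\<And>z. z \<in> topspace T \<Longrightarrow> j (h z) = z" "\<And>y. y \<in> topspace Y \<Longrightarrow> h (j y) = y"
    by (auto simp: homeomorphic_maps_def)
  then have "h z \<in> topspace Y" if "z \<in> topspace T" for z
    using that by (auto simp: continuous_map_def)
  then show ?thesis
    using T act_in_topspace[OF flow] g_flow_transport[OF flow hom]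
    by (intro that[of T "\<lambda>z g. j (act (h z) g)" h j]) (auto simp: g_map_def)
qed

section \<open>The greatest ambit\<close>

text \<open>Any point of a flow becomes the base point of an ambit inside the intersection of the
  closed invariant sets containing it.\<close>

lemma orbit_closure:
  assumes "g_flow X act" "x \<in> topspace X"
  obtains C where "closedin X C" "invariant act C" "x \<in> C" "x \<in> ambit_set (subtopology X C) act"
proof -
  let ?K = "{D. closedin X D \<and> invariant act D \<and> x \<in> D}"
  have "topspace X \<in> ?K"
    using assms by (simp add: invariant_topspace)
  then have C: "closedin X (\<Inter>?K)" "invariant act (\<Inter>?K)" "x \<in> \<Inter>?K"
    by (auto simp: invariant_def intro!: closedin_Inter)
  have "topspace (subtopology X (\<Inter>?K)) = \<Inter>?K"
    using C(1) closedin_subset by auto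
  moreover have "D = \<Inter>?K" if "closedin (subtopology X (\<Inter>?K)) D" "invariant act D" "x \<in> D" for D
    using that closedin_closed_subtopology[OF C(1)] by blast
  ultimately have "x \<in> ambit_set (subtopology X (\<Inter>?K)) act"
    using C(3) unfolding ambit_set_iff[OF g_flow_subtopology[OF assms(1) C(1,2)]] by simp
  then show ?thesis
    using C that by blast
qed

text \<open>The universal ambit with a base point. A formula cannot quantify over types, and
  \<open>'g set set\<close> has room for a copy of every ambit.\<close>

definition greatest_ambit ::
  "'e topology \<Rightarrow> ('e \<Rightarrow> 'g::topological_group_add \<Rightarrow> 'e) \<Rightarrow> 'e \<Rightarrow> bool" where
  "greatest_ambit E actE e \<longleftrightarrow> g_flow E actE \<and> e \<in> ambit_set E actE \<and>
     (\<forall>(Y :: 'g set set topology) actY y. g_flow Y actY \<and> y \<in> ambit_set Y actY \<longrightarrow>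
        (\<exists>f. g_map E actE Y actY f \<and> f e = y))"

text \<open>Frees the universal property from the type \<open>'g set set\<close>: map into a copy of
  \<open>Y\<close>, then back to \<open>Y\<close> by the isomorphism.\<close>

lemma greatest_ambit_map:
  fixes Y :: "'y topology" and actY :: "'y \<Rightarrow> 'g::topological_group_add \<Rightarrow> 'y"
  assumes "greatest_ambit E actE e" "g_flow Y actY" "y \<in> ambit_set Y actY"
  obtains f where "g_map E actE Y actY f" "f e = y"
proof -
  have y: "y \<in> topspace Y" and pre: "pre_ambit Y actY"
    using assms(2,3) by (auto simp: ambit_set_def pre_ambit_def)
  obtain T :: "'g set set topology" and actT h j where T: "g_flow T actT"
    "g_map T actT Y actY h" "g_map Y actY T actT j"
    "\<And>z. z \<in> topspace T \<Longrightarrow> j (h z) = z" "\<And>y. y \<in> topspace Y \<Longrightarrow> h (j y) = y"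
    by (rule pre_ambit_copy[OF pre]) blast
  have "j ` topspace Y = topspace T"
    using T(4) g_map_image_topspace[OF T(2)] g_map_image_topspace[OF T(3)]
    by (metis image_eqI image_subset_iff subsetI subset_antisym)
  then have "j y \<in> ambit_set T actT"
    by (rule ambit_set_image[OF assms(2) T(1) T(3) _ assms(3)])
  then obtain f where "g_map E actE T actT f" "f e = j y"
    using assms(1) T(1) unfolding greatest_ambit_def by blast
  then show ?thesis
    using that[OF g_map_compose[OF _ T(2)]] T(5)[OF y] by simp
qed

text \<open>The orbit closure of the tuple of base points in the product of all ambits on \<open>'g set set\<close>.\<close>
lemma greatest_ambit_exists:
  obtains E :: "'g::topological_group_add set set topology"
    and actE :: "'g set set \<Rightarrow> 'g \<Rightarrow> 'g set set" and e where "greatest_ambit E actE e"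
proof -
  define I where "I = {(Y :: 'g set set topology, actY :: 'g set set \<Rightarrow> 'g \<Rightarrow> _, y).
    g_flow Y actY \<and> y \<in> ambit_set Y actY}"
  let ?P = "product_topology fst I" and ?act = "\<lambda>p g. \<lambda>i\<in>I. (fst (snd i)) (p i) g"
  define e where "e = (\<lambda>i\<in>I. snd (snd i))"
  have P: "g_flow ?P ?act"
    by (rule g_flow_product) (auto simp: I_def)
  have "e \<in> topspace ?P"
    by (auto simp: e_def I_def ambit_set_def)
  then obtain C where C: "closedin ?P C" "invariant ?act C" "e \<in> C"
    "e \<in> ambit_set (subtopology ?P C) ?act"
    by (rule orbit_closure[OF P])
  have flow: "g_flow (subtopology ?P C) ?act"
    by (rule g_flow_subtopology[OF P C(1,2)])
  \<comment> \<open>The points of this flow are families indexed by \<open>I\<close>, but its dense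
    orbit gives it a copy on \<open>'g set set\<close>, with base point \<open>j e\<close>.\<close>
  then have pre: "pre_ambit (subtopology ?P C) ?act"
    using C(4) by (auto simp: pre_ambit_def)
  obtain E :: "'g set set topology" and actE :: "'g set set \<Rightarrow> 'g \<Rightarrow> 'g set set" and h j where E: "g_flow E actE"
    "g_map E actE (subtopology ?P C) ?act h" "g_map (subtopology ?P C) ?act E actE j"
    "\<And>z. z \<in> topspace E \<Longrightarrow> j (h z) = z"
    "\<And>p. p \<in> topspace (subtopology ?P C) \<Longrightarrow> h (j p) = p"
    by (rule pre_ambit_copy[OF pre]) blast
  have "j ` topspace (subtopology ?P C) = topspace E"
    using E(4) g_map_image_topspace[OF E(2)] g_map_image_topspace[OF E(3)]
    by (metis image_eqI image_subset_iff subsetI subset_antisym)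
  then have je: "j e \<in> ambit_set E actE"
    by (rule ambit_set_image[OF flow E(1) E(3) _ C(4)])
  have "\<exists>f. g_map E actE Y actY f \<and> f (j e) = y"
    if "g_flow Y actY" "y \<in> ambit_set Y actY" for Y :: "'g set set topology" and actY y
  proof -
    have i: "(Y, actY, y) \<in> I"
      using that by (simp add: I_def)
    \<comment> \<open>The ambit \<open>(Y, actY, y)\<close> is itself an index, and the projection
      at this index sends \<open>e\<close> to \<open>y\<close>.\<close>
    have "g_map ?P ?act Y actY (\<lambda>p. p (Y, actY, y))"
      using g_map_product_projection[OF i, of fst "\<lambda>i. fst (snd i)"] by simp
    from g_map_compose[OF E(2) g_map_from_subtopology[OF this]]
    have "g_map E actE Y actY (\<lambda>z. h z (Y, actY, y))" .
    moreover have "h (j e) = e"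
      using E(5) C(4) by (simp add: ambit_set_def)
    ultimately show ?thesis
      using i by (intro exI[of _ "\<lambda>z. h z (Y, actY, y)"]) (simp add: e_def)
  qed
  then have "greatest_ambit E actE (j e)"
    using E(1) je by (simp add: greatest_ambit_def)
  then show ?thesis
    by (rule that)
qed

section \<open>Minimal subflows onto \<open>X\<close>, and strong extensions\<close>

text \<open>By Zorn's lemma. Surjectivity survives the intersection of a chain: the fibre over
  \<open>x\<close> meets each member in a nonempty closed set, and by compactness these sets have a
  common point.\<close>

lemma minimal_onto_exists:
  assumes "g_flow W actW" "g_flow X actX" "g_map W actW X actX f" "f ` topspace W = topspace X"
  obtains S where "closedin W S" "invariant actW S" "f ` S = topspace X"
    "\<And>D. \<lbrakk>closedin W D; invariant actW D; D \<subseteq> S; f ` D = topspace X\<rbrakk> \<Longrightarrow> D = S"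
proof -
  define \<A> where "\<A> = {D. closedin W D \<and> invariant actW D \<and> f ` D = topspace X}"
  have "\<exists>S\<in>\<A>. \<forall>D\<in>\<A>. D \<subseteq> S \<longrightarrow> D = S"
  proof (rule Inter_Zorn_nonempty)
    show "\<A> \<noteq> {}"
      using assms(4) invariant_topspace[OF assms(1)] by (auto simp: \<A>_def)
    fix \<C> assume \<C>: "\<C> \<noteq> {}" "subset.chain \<A> \<C>"
    then have sub: "\<C> \<subseteq> \<A>" and chain: "\<And>C D. C \<in> \<C> \<Longrightarrow> D \<in> \<C> \<Longrightarrow> C \<subseteq> D \<or> D \<subseteq> C"
      by (auto simp: subset_chain_def)
    have "x \<in> f ` \<Inter>\<C>" if x: "x \<in> topspace X" for x
    proof -
      let ?F = "\<lambda>C. {w \<in> topspace W. f w \<in> {x}} \<inter> C"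
      have "closedin X {x}"
        using assms(2) x by (simp add: g_flow_def closedin_Hausdorff_singleton)
      from closedin_vimage[OF assms(3) this]
      have "closedin W {w \<in> topspace W. f w \<in> {x}}" .
      then have "closedin W (?F C)" if "C \<in> \<C>" for C
        using that sub by (intro closedin_Int) (auto simp: \<A>_def)
      moreover have "?F C \<noteq> {}" if "C \<in> \<C>" for C
      proof -
        have "x \<in> f ` C" "C \<subseteq> topspace W"
          using that x sub closedin_subset[of W C] by (auto simp: \<A>_def)
        then show ?thesis
          by blast
      qed
      moreover have "subset.chain UNIV (?F ` \<C>)"
        using chain by (fastforce simp: subset_chain_def)
      ultimately have "\<Inter>(?F ` \<C>) \<noteq> {}"
        using assms(1) \<C>(1) by (intro compact_space_Inter_chain[of W]) (auto simp: g_flow_def)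
      then show ?thesis
        using \<C>(1) by auto
    qed
    moreover have "f ` \<Inter>\<C> \<subseteq> topspace X"
      using \<C>(1) sub by (auto simp: \<A>_def)
    ultimately show "\<Inter>\<C> \<in> \<A>"
      using \<C>(1) sub by (auto simp: \<A>_def invariant_def intro!: closedin_Inter)
  qed
  then show ?thesis
    using that by (auto simp: \<A>_def)
qed

text \<open>If \<open>f s\<close> has dense orbit, every closed invariant \<open>D\<close> in
  \<open>S\<close> containing \<open>s\<close> maps onto \<open>X\<close>, and minimality gives
  \<open>D = S\<close>; so \<open>s\<close> has dense orbit in \<open>S\<close>. The converse holds
  because \<open>f\<close> maps \<open>S\<close> onto \<open>X\<close>.\<close>

lemma strong_extension_minimal_onto:
  assumes "g_flow W actW" "pre_ambit X actX" "g_map W actW X actX f"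
    and "closedin W S" "invariant actW S" "f ` S = topspace X"
    and "\<And>D. \<lbrakk>closedin W D; invariant actW D; D \<subseteq> S; f ` D = topspace X\<rbrakk> \<Longrightarrow> D = S"
  shows "strong_extension X actX (subtopology W S) actW f"
proof -
  let ?S = "subtopology W S"
  have X: "g_flow X actX"
    using assms(2) by (simp add: pre_ambit_def)
  have S: "g_flow ?S actW"
    using assms by (intro g_flow_subtopology)
  have top: "topspace ?S = S"
    using closedin_subset[OF assms(4)] by auto
  have f: "g_map ?S actW X actX f"
    by (rule g_map_from_subtopology[OF assms(3)])
  have up: "s \<in> ambit_set ?S actW" if s: "s \<in> S" "f s \<in> ambit_set X actX" for s
  proof -
    have "D = S" if D: "closedin ?S D" "invariant actW D" "s \<in> D" for D
    proof -
      have D': "closedin W D" "D \<subseteq> S"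
        using D(1) closedin_closed_subtopology[OF assms(4)] by auto
      have "closedin X (f ` D)" "invariant actX (f ` D)" "f s \<in> f ` D"
        using closedin_g_map_image[OF S X f D(1)] D D'(2) top invariant_g_map_image[OF f D(2)]
        by auto
      then have "f ` D = topspace X"
        using s(2) ambit_set_iff[OF X] by blast
      then show ?thesis
        using assms(7) D' D(2) by blast
    qed
    then show ?thesis
      using s(1) unfolding ambit_set_iff[OF S] top by blast
  qed
  obtain x where "x \<in> ambit_set X actX"
    using assms(2) by (auto simp: pre_ambit_def)
  moreover from this have "x \<in> f ` S"
    using assms(6) by (simp add: ambit_set_def)
  then obtain s where "s \<in> S" "f s = x"
    by blast
  ultimately have "pre_ambit ?S actW"
    using up S by (auto simp: pre_ambit_def)
  moreover have "f s \<in> ambit_set X actX" if "s \<in> ambit_set ?S actW" for s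
    using ambit_set_image[OF S X f _ that] assms(6) top by simp
  ultimately show ?thesis
    using up f by (auto simp: strong_extension_def strong_map_def top)
qed

lemma strong_extensionD:
  assumes "strong_extension X actX Y actY \<psi>"
  shows "g_flow Y actY" "g_map Y actY X actX \<psi>"
    "\<And>y. y \<in> topspace Y \<Longrightarrow> y \<in> ambit_set Y actY \<longleftrightarrow> \<psi> y \<in> ambit_set X actX"
  using assms by (auto simp: strong_extension_def strong_map_def pre_ambit_def)

lemma strong_extension_surj:
  assumes "g_flow X actX" "strong_extension X actX Y actY \<psi>"
  shows "\<psi> ` topspace Y = topspace X"
proof -
  note D = strong_extensionD[OF assms(2)]
  obtain y where y: "y \<in> ambit_set Y actY"
    using assms(2) by (auto simp: strong_extension_def pre_ambit_def)
  then have "y \<in> topspace Y"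
    by (simp add: ambit_set_def)
  then show ?thesis
    using ambit_surj[OF D(1) assms(1) D(2)] D(3) y by blast
qed

text \<open>Both extensions detect dense orbits by the images in \<open>X\<close>, so a flow map
  over \<open>X\<close> is automatically strong.\<close>

lemma strong_map_over:
  assumes "strong_extension X actX Z actZ \<psi>Z" "strong_extension X actX Y actY \<psi>Y"
    and "g_map Z actZ Y actY \<phi>" "\<And>z. z \<in> topspace Z \<Longrightarrow> \<psi>Y (\<phi> z) = \<psi>Z z"
  shows "strong_map Z actZ Y actY \<phi>"
proof -
  have "\<phi> z \<in> topspace Y" if "z \<in> topspace Z" for z
    using that g_map_image_topspace[OF assms(3)] by blast
  then show ?thesis
    using assms(3,4) strong_extensionD(3)[OF assms(1)] strong_extensionD(3)[OF assms(2)]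
    by (auto simp: strong_map_def)
qed

lemma strong_map_surj:
  assumes "g_flow X actX" "g_flow Y actY" "strong_map X actX Y actY f" "ambit_set X actX \<noteq> {}"
  shows "f ` topspace X = topspace Y"
proof -
  obtain x where x: "x \<in> ambit_set X actX"
    using assms(4) by blast
  then have "x \<in> topspace X"
    by (simp add: ambit_set_def)
  then show ?thesis
    using ambit_surj[OF assms(1,2)] assms(3) x by (auto simp: strong_map_def)
qed

section \<open>Idempotents, and the endomorphisms of a minimal subflow over \<open>X\<close>\<close>

text \<open>The Ellis-Numakura lemma, with continuity in the right factor only. Any element of a
  minimal closed subsemigroup turns out to be idempotent.\<close>

lemma idempotent_exists:
  assumes "compact_space X" "Hausdorff_space X" "topspace X \<noteq> {}"
    and "\<And>p. p \<in> topspace X \<Longrightarrow> continuous_map X X (m p)"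
    and "\<And>p q r. \<lbrakk>p \<in> topspace X; q \<in> topspace X; r \<in> topspace X\<rbrakk> \<Longrightarrow> m (m p q) r = m p (m q r)"
  obtains u where "u \<in> topspace X" "m u u = u"
proof -
  define \<A> where "\<A> = {B. closedin X B \<and> B \<noteq> {} \<and> (\<forall>p\<in>B. \<forall>q\<in>B. m p q \<in> B)}"
  have in_top: "m p q \<in> topspace X" if "p \<in> topspace X" "q \<in> topspace X" for p q
    using assms(4)[OF that(1)] that(2) by (auto simp: continuous_map_def)
  have "\<exists>B\<in>\<A>. \<forall>D\<in>\<A>. D \<subseteq> B \<longrightarrow> D = B"
  proof (rule Inter_Zorn_nonempty)
    show "\<A> \<noteq> {}"
      using assms(3) in_top by (auto simp: \<A>_def)
    fix \<C> assume \<C>: "\<C> \<noteq> {}" "subset.chain \<A> \<C>"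
    then have sub: "\<C> \<subseteq> \<A>" and "subset.chain UNIV \<C>"
      by (auto simp: subset_chain_def)
    then have "\<Inter>\<C> \<noteq> {}"
      using assms(1) \<C>(1) by (intro compact_space_Inter_chain[of X]) (auto simp: \<A>_def)
    then show "\<Inter>\<C> \<in> \<A>"
      using \<C>(1) sub unfolding \<A>_def by (auto intro!: closedin_Inter)
  qed
  then obtain B where "B \<in> \<A>" and min: "\<And>D. D \<in> \<A> \<Longrightarrow> D \<subseteq> B \<Longrightarrow> D = B"
    by blast
  then have B: "closedin X B" "B \<noteq> {}" "\<And>p q. p \<in> B \<Longrightarrow> q \<in> B \<Longrightarrow> m p q \<in> B"
    by (auto simp: \<A>_def)
  obtain b where b: "b \<in> B"
    using B(2) by blast
  have top: "B \<subseteq> topspace X"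
    using closedin_subset[OF B(1)] .
  have bX: "b \<in> topspace X"
    using b top by blast
  have "closed_map X X (m b)"
    using continuous_imp_closed_map[OF assms(4)[OF bX] assms(1,2)] .
  then have "closedin X (m b ` B)"
    using B(1) by (simp add: closed_map_def)
  moreover have "m p q \<in> m b ` B" if pq: "p \<in> m b ` B" "q \<in> m b ` B" for p q
  proof -
    obtain p' where p': "p' \<in> B" "p = m b p'"
      using pq(1) by blast
    have "q \<in> B"
      using pq(2) B(3) b by blast
    then have "m p q = m b (m p' q)" "m p' q \<in> B"
      using p' assms(5) b top B(3) by auto
    then show ?thesis
      by blast
  qed
  ultimately have "m b ` B \<in> \<A>"
    using b unfolding \<A>_def by auto
  then have "m b ` B = B"
    using min B(3) b by blast
  then obtain c where c: "c \<in> B" "m b c = b"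
    using b by (metis imageE)
  \<comment> \<open>The solutions \<open>q\<close> in \<open>B\<close> of \<open>m b q = b\<close>
    form a closed subsemigroup, nonempty because of \<open>c\<close>. By minimality \<open>b\<close>
    itself is one of them.\<close>
  define D where "D = {q \<in> topspace X. m b q \<in> {b}} \<inter> B"
  have "closedin X D"
    using B(1) closedin_Hausdorff_singleton[OF assms(2) bX]
      closedin_continuous_map_preimage[OF assms(4)[OF bX]]
    unfolding D_def by (intro closedin_Int)
  moreover have "m p q \<in> D" if "p \<in> D" "q \<in> D" for p q
    using that B(3) assms(5)[of b p q] bX in_top by (auto simp: D_def)
  ultimately have "D \<in> \<A>"
    using c top by (auto simp: \<A>_def D_def)
  then have "D = B"
    using min by (auto simp: D_def)
  then show ?thesis
    using that b bX by (auto simp: D_def)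
qed

text \<open>Injectivity is what uniqueness needs of these endomorphisms, since strong maps between
  pre-ambits are onto anyway.\<close>

lemma minimal_onto_coalescent:
  assumes E: "greatest_ambit E actE e" and X: "g_flow X actX"
    and \<pi>: "g_map E actE X actX \<pi>" "\<pi> e \<in> ambit_set X actX"
    and S: "closedin E S" "invariant actE S" "\<pi> ` S = topspace X"
    and min: "\<And>D. \<lbrakk>closedin E D; invariant actE D; D \<subseteq> S; \<pi> ` D = topspace X\<rbrakk> \<Longrightarrow> D = S"
    and \<phi>: "g_map (subtopology E S) actE (subtopology E S) actE \<phi>"
    and over: "\<And>s. s \<in> S \<Longrightarrow> \<pi> (\<phi> s) = \<pi> s"
  shows "inj_on \<phi> S"
proof -
  have flow: "g_flow E actE" and e: "e \<in> ambit_set E actE"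
    using E by (auto simp: greatest_ambit_def)
  have SE: "S \<subseteq> topspace E"
    using closedin_subset[OF S(1)] .
  \<comment> \<open>The orbit closure of \<open>p\<close> is an ambit with base point
    \<open>p\<close>, so it receives a map from \<open>E\<close>.\<close>
  have "\<exists>f. g_map E actE E actE f \<and> f e = p" if p: "p \<in> topspace E" for p
  proof -
    obtain C where C: "closedin E C" "invariant actE C" "p \<in> C"
      "p \<in> ambit_set (subtopology E C) actE"
      by (rule orbit_closure[OF flow p])
    obtain f where "g_map E actE (subtopology E C) actE f" "f e = p"
      by (rule greatest_ambit_map[OF E g_flow_subtopology[OF flow C(1,2)] C(4)])
    then show ?thesis
      using g_map_into_fulltopology by blast
  qed
  then obtain L where L: "\<And>p. p \<in> topspace E \<Longrightarrow> g_map E actE E actE (L p)"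
    and Le: "\<And>p. p \<in> topspace E \<Longrightarrow> L p e = p"
    by metis
  have LE: "L p q \<in> topspace E" if "p \<in> topspace E" "q \<in> topspace E" for p q
    using g_map_image_topspace[OF L[OF that(1)]] that(2) by blast
  \<comment> \<open>Both sides are flow maps in \<open>r\<close> with the value \<open>L p q\<close>
    at \<open>e\<close>.\<close>
  have assoc: "L (L p q) r = L p (L q r)"
    if "p \<in> topspace E" "q \<in> topspace E" "r \<in> topspace E" for p q r
    by (rule g_map_eq_on_orbit_closure[OF flow flow e, where h = "\<lambda>r. L p (L q r)"])
       (use that in \<open>auto simp: L Le LE intro: g_map_compose[OF L L]\<close>)
  \<comment> \<open>\<open>S\<close> is a right ideal: the \<open>q\<close> with
    \<open>L p q\<close> in \<open>S\<close> form a closed invariant set, which contains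
    \<open>e\<close> because \<open>L p e = p\<close>.\<close>
  have LS: "L p q \<in> S" if "p \<in> S" "q \<in> topspace E" for p q
  proof -
    have p: "p \<in> topspace E"
      using that(1) SE by blast
    have "{q \<in> topspace E. L p q \<in> S} = topspace E"
      using e closedin_vimage[OF L[OF p] S(1)] invariant_vimage[OF flow L[OF p] S(2)] that(1)
      unfolding ambit_set_iff[OF flow] by (auto simp: Le p)
    then show ?thesis
      using that(2) by blast
  qed
  \<comment> \<open>The fibre of \<open>S\<close> over \<open>\<pi> e\<close>; the singleton puts it
    in the form that \<open>closedin_vimage\<close> expects.\<close>
  define T where "T = {p \<in> topspace E. \<pi> p \<in> {\<pi> e}} \<inter> S"
  have T: "p \<in> T \<longleftrightarrow> p \<in> S \<and> \<pi> p = \<pi> e" for p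
    using SE by (auto simp: T_def)
  \<comment> \<open>Left multiplication by a point over \<open>\<pi> e\<close> is a map over
    \<open>X\<close>, because both sides agree at \<open>q = e\<close>.\<close>
  have \<pi>L: "\<pi> (L p q) = \<pi> q" if "p \<in> T" "q \<in> topspace E" for p q
  proof -
    have p: "p \<in> topspace E" "\<pi> p = \<pi> e"
      using that(1) SE T by auto
    show ?thesis
      by (rule g_map_eq_on_orbit_closure[OF flow X e, where f = "\<lambda>q. \<pi> (L p q)"])
         (use p that in \<open>auto simp: \<pi> Le intro: g_map_compose[OF L \<pi>(1)]\<close>)
  qed
  \<comment> \<open>\<open>L p\<close> maps \<open>S\<close> into itself and preserves
    \<open>\<pi>\<close>, so the image of \<open>S\<close> is a subflow of \<open>S\<close> that
    still covers \<open>X\<close>. By minimality it is \<open>S\<close>.\<close>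
  have solve: "\<exists>t\<in>S. L p t = s" if "p \<in> T" "s \<in> S" for p s
  proof -
    have p: "p \<in> topspace E" "p \<in> S"
      using that(1) SE T by auto
    have "L p ` S = S"
    proof (rule min)
      show "closedin E (L p ` S)"
        by (rule closedin_g_map_image[OF flow flow L[OF p(1)] S(1)])
      show "invariant actE (L p ` S)"
        by (rule invariant_g_map_image[OF L[OF p(1)] S(2) SE])
      show "L p ` S \<subseteq> S"
        using LS p(2) SE by blast
      have "\<pi> ` L p ` S = \<pi> ` S"
        unfolding image_image using SE by (intro image_cong) (auto simp: \<pi>L that(1))
      then show "\<pi> ` L p ` S = topspace X"
        using S(3) by simp
    qed
    then show ?thesis
      using that(2) by (metis imageE)
  qed
  have closedT: "closedin E T"
    unfolding T_def using closedin_Hausdorff_singleton X \<pi>(2) S(1)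
    by (intro closedin_Int closedin_vimage[OF \<pi>(1)]) (auto simp: g_flow_def ambit_set_def)
  have topT: "topspace (subtopology E T) = T"
    using closedin_subset[OF closedT] by auto
  obtain u where u: "u \<in> T" "L u u = u"
  proof (rule idempotent_exists[of "subtopology E T" L])
    show "compact_space (subtopology E T)"
      using flow closedT closedin_compact_space compact_space_subtopology
      by (auto simp: g_flow_def)
    show "Hausdorff_space (subtopology E T)"
      using flow by (simp add: g_flow_def Hausdorff_space_subtopology)
    have "\<pi> e \<in> \<pi> ` S"
      using S(3) \<pi>(2) by (simp add: ambit_set_def)
    then show "topspace (subtopology E T) \<noteq> {}"
      unfolding topT using T by fastforce
    show "continuous_map (subtopology E T) (subtopology E T) (L p)"
      if "p \<in> topspace (subtopology E T)" for p
      using that SE L[of p] LS T \<pi>L unfolding topT continuous_map_in_subtopology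
      by (auto simp: g_map_def continuous_map_from_subtopology subset_iff)
    show "L (L p q) r = L p (L q r)"
      if "p \<in> topspace (subtopology E T)" "q \<in> topspace (subtopology E T)"
        "r \<in> topspace (subtopology E T)" for p q r
      using that by (intro assoc) auto
  qed (use that topT in auto)
  have uE: "u \<in> topspace E" "u \<in> S"
    using u(1) T SE by auto
  \<comment> \<open>Write \<open>s\<close> as \<open>L u t\<close> and use that \<open>u\<close> is
    idempotent.\<close>
  have Lu: "L u s = s" if s: "s \<in> S" for s
  proof -
    obtain t where "t \<in> S" "L u t = s"
      using solve[OF u(1) s] by blast
    then show ?thesis
      using assoc[OF uE(1) uE(1), of t] u(2) SE by auto
  qed
  have \<phi>S: "\<phi> s \<in> S" if "s \<in> S" for s
    using g_map_image_topspace[OF \<phi>] that SE by auto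
  define p where "p = \<phi> u"
  have p: "p \<in> T" "p \<in> S" "p \<in> topspace E"
    using \<phi>S[OF uE(2)] over[OF uE(2)] u(1) T SE by (auto simp: p_def)
  have \<phi>_eq: "\<phi> s = L p s" if s: "s \<in> S" for s
  proof -
    \<comment> \<open>\<open>\<phi>\<close> is a flow map on \<open>S\<close> only. Precomposing
      with \<open>L u\<close>, which maps \<open>E\<close> into \<open>S\<close> and fixes
      \<open>S\<close> pointwise, gives a flow map on \<open>E\<close> that can be compared with
      \<open>L p\<close> at \<open>e\<close>.\<close>
    have "g_map E actE (subtopology E S) actE (L u)"
      using L[OF uE(1)] LS[OF uE(2)] by (auto simp: g_map_def continuous_map_in_subtopology)
    from g_map_into_fulltopology[OF g_map_compose[OF this \<phi>]]
    have "g_map E actE E actE (\<lambda>s. \<phi> (L u s))" .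
    then have "\<phi> (L u s) = L p s"
      by (rule g_map_eq_on_orbit_closure[OF flow flow e])
         (use s SE uE(1) p(3) in \<open>auto simp: L Le p_def\<close>)
    then show ?thesis
      using Lu[OF s] by simp
  qed
  have inverse: "\<exists>q\<in>T. L p q = u" if p: "p \<in> T" for p
  proof -
    obtain q where q: "q \<in> S" "L p q = u"
      using solve[OF p uE(2)] by blast
    then have "\<pi> q = \<pi> e"
      using \<pi>L[OF p, of q] u(1) T SE by auto
    then show ?thesis
      using q T by blast
  qed
  \<comment> \<open>As in a group, a right inverse \<open>q\<close> of \<open>p\<close> that has a
    right inverse \<open>r\<close> of its own is also a left inverse. The identity
    \<open>p = L p u\<close> needed for this is the formula for \<open>\<phi>\<close> at
    \<open>u\<close>.\<close>
  obtain q where q: "q \<in> T" "L p q = u"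
    using inverse[OF p(1)] by blast
  obtain r where r: "r \<in> T" "L q r = u"
    using inverse[OF q(1)] by blast
  have qr: "q \<in> topspace E" "r \<in> S" "r \<in> topspace E"
    using q(1) r(1) T SE by auto
  have "p = L p u"
    using \<phi>_eq[OF uE(2)] by (simp add: p_def)
  also have "\<dots> = L u r"
    using assoc[OF p(3) qr(1,3)] q(2) r(2) by simp
  also have "\<dots> = r"
    by (rule Lu[OF qr(2)])
  finally have "L q p = u"
    using r(2) by simp
  then have "L q (\<phi> s) = s" if "s \<in> S" for s
    using assoc[OF qr(1) p(3), of s] \<phi>_eq[OF that] Lu[OF that] that SE by auto
  then show ?thesis
    by (rule inj_on_inverseI)
qed

section \<open>Existence of a universal strong extension\<close>

text \<open>Besides universality, the injectivity clause is all that the uniqueness proof uses of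
  the construction.\<close>

lemma coalescent_universal_strong_extension:
  fixes X :: "'x topology" and actX :: "'x \<Rightarrow> 'g::topological_group_add \<Rightarrow> 'x"
  assumes "pre_ambit X actX"
  obtains S :: "'g set set topology" and actS \<psi> where
    "universal_strong_extension TYPE('g set set) X actX S actS \<psi>"
    "\<And>\<phi>. g_map S actS S actS \<phi> \<Longrightarrow> (\<And>s. s \<in> topspace S \<Longrightarrow> \<psi> (\<phi> s) = \<psi> s) \<Longrightarrow>
      inj_on \<phi> (topspace S)"
proof -
  obtain E :: "'g set set topology" and actE :: "'g set set \<Rightarrow> 'g \<Rightarrow> 'g set set" and e
    where E: "greatest_ambit E actE e"
    by (rule greatest_ambit_exists)
  have flow: "g_flow E actE" and e: "e \<in> ambit_set E actE"
    using E by (auto simp: greatest_ambit_def)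
  have eE: "e \<in> topspace E"
    using e by (simp add: ambit_set_def)
  obtain x where X: "g_flow X actX" and x: "x \<in> ambit_set X actX"
    using assms by (auto simp: pre_ambit_def)
  obtain \<pi> where \<pi>: "g_map E actE X actX \<pi>" "\<pi> e = x"
    by (rule greatest_ambit_map[OF E X x])
  then have "\<pi> ` topspace E = topspace X"
    using ambit_surj[OF flow X] eE x by blast
  then obtain S where S: "closedin E S" "invariant actE S" "\<pi> ` S = topspace X"
    and min: "\<And>D. \<lbrakk>closedin E D; invariant actE D; D \<subseteq> S; \<pi> ` D = topspace X\<rbrakk> \<Longrightarrow> D = S"
    using minimal_onto_exists[OF flow X \<pi>(1)] by metis
  have top: "topspace (subtopology E S) = S"
    using closedin_subset[OF S(1)] by auto
  have strong: "strong_extension X actX (subtopology E S) actE \<pi>"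
    by (rule strong_extension_minimal_onto[OF flow assms \<pi>(1) S min])
  have "\<exists>\<phi>. strong_map (subtopology E S) actE Y actY \<phi> \<and>
      (\<forall>s\<in>topspace (subtopology E S). \<psi> (\<phi> s) = \<pi> s)"
    if Y: "strong_extension X actX Y actY \<psi>" for Y :: "'g set set topology" and actY \<psi>
  proof -
    note YD = strong_extensionD[OF Y]
    have "x \<in> \<psi> ` topspace Y"
      using strong_extension_surj[OF X Y] x by (simp add: ambit_set_def)
    then obtain y where y: "y \<in> topspace Y" "\<psi> y = x"
      by blast
    then have "y \<in> ambit_set Y actY"
      using YD(3) x by blast
    then obtain f where f: "g_map E actE Y actY f" "f e = y"
      by (rule greatest_ambit_map[OF E YD(1)])
    \<comment> \<open>Both sides are flow maps from \<open>E\<close> to \<open>X\<close> that send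
      \<open>e\<close> to \<open>x\<close>.\<close>
    have "\<psi> (f z) = \<pi> z" if "z \<in> topspace E" for z
      by (rule g_map_eq_on_orbit_closure[OF flow X e g_map_compose[OF f(1) YD(2)] \<pi>(1)])
         (use f y \<pi> that in auto)
    then have "\<forall>s\<in>topspace (subtopology E S). \<psi> (f s) = \<pi> s"
      by simp
    then show ?thesis
      using strong_map_over[OF strong Y g_map_from_subtopology[OF f(1)]] by blast
  qed
  then have "universal_strong_extension TYPE('g set set) X actX (subtopology E S) actE \<pi>"
    using strong by (simp add: universal_strong_extension_def)
  moreover have "inj_on \<phi> (topspace (subtopology E S))"
    if "g_map (subtopology E S) actE (subtopology E S) actE \<phi>"
      "\<And>s. s \<in> topspace (subtopology E S) \<Longrightarrow> \<pi> (\<phi> s) = \<pi> s" for \<phi>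
    unfolding top
    by (rule minimal_onto_coalescent[OF E X \<pi>(1) _ S min that(1)]) (use \<pi> x that(2) top in auto)
  ultimately show ?thesis
    by (rule that)
qed

text \<open>A competitor \<open>Z\<close> has a copy \<open>T\<close> on \<open>'g set set\<close>,
  which is a strong extension through \<open>h\<close>. Universality gives a map into
  \<open>T\<close>, and \<open>h\<close> carries it to \<open>Z\<close>.\<close>

lemma universal_strong_extension_any_type:
  fixes X :: "'x topology" and actX :: "'x \<Rightarrow> 'g::topological_group_add \<Rightarrow> 'x"
  assumes X: "g_flow X actX"
    and U: "universal_strong_extension TYPE('g set set) X actX Y actY \<psi>"
  shows "universal_strong_extension TYPE('z) X actX Y actY \<psi>"
proof -
  have Y: "strong_extension X actX Y actY \<psi>"
    using U by (simp add: universal_strong_extension_def)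
  have "\<exists>\<phi>. strong_map Y actY Z actZ \<phi> \<and> (\<forall>y\<in>topspace Y. \<psi>Z (\<phi> y) = \<psi> y)"
    if Z: "strong_extension X actX Z actZ \<psi>Z" for Z :: "'z topology" and actZ \<psi>Z
  proof -
    have pre: "pre_ambit Z actZ"
      using Z by (simp add: strong_extension_def)
    note ZD = strong_extensionD[OF Z]
    obtain T :: "'g set set topology" and actT h j where T: "g_flow T actT"
      "g_map T actT Z actZ h" "g_map Z actZ T actT j"
      "\<And>t. t \<in> topspace T \<Longrightarrow> j (h t) = t" "\<And>z. z \<in> topspace Z \<Longrightarrow> h (j z) = z"
      by (rule pre_ambit_copy[OF pre]) blast
    have h: "h ` topspace T = topspace Z" and j: "j ` topspace Z = topspace T"
      using T(4,5) g_map_image_topspace[OF T(2)] g_map_image_topspace[OF T(3)]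
      by (metis image_eqI image_subset_iff subsetI subset_antisym)+
    have amb: "t \<in> ambit_set T actT \<longleftrightarrow> h t \<in> ambit_set Z actZ" if "t \<in> topspace T" for t
      using ambit_set_image[OF T(1) ZD(1) T(2) h, of t] T(4)[OF that]
        ambit_set_image[OF ZD(1) T(1) T(3) j, of "h t"] by auto
    have "strong_extension X actX T actT (\<lambda>t. \<psi>Z (h t))"
      unfolding strong_extension_def strong_map_def
    proof (intro conjI ballI)
      obtain z where "z \<in> ambit_set Z actZ"
        using pre by (auto simp: pre_ambit_def)
      then show "pre_ambit T actT"
        using ambit_set_image[OF ZD(1) T(1) T(3) j] T(1) by (auto simp: pre_ambit_def)
      show "g_map T actT X actX (\<lambda>t. \<psi>Z (h t))"
        by (rule g_map_compose[OF T(2) ZD(2)])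
      show "t \<in> ambit_set T actT \<longleftrightarrow> \<psi>Z (h t) \<in> ambit_set X actX" if "t \<in> topspace T" for t
        using amb[OF that] ZD(3)[of "h t"] h that by auto
    qed
    then have "\<exists>\<phi>. strong_map Y actY T actT \<phi> \<and> (\<forall>y\<in>topspace Y. \<psi>Z (h (\<phi> y)) = \<psi> y)"
      using U unfolding universal_strong_extension_def by blast
    then obtain \<phi> where \<phi>: "strong_map Y actY T actT \<phi>" "\<forall>y\<in>topspace Y. \<psi>Z (h (\<phi> y)) = \<psi> y"
      by blast
    have "g_map Y actY Z actZ (\<lambda>y. h (\<phi> y))"
      using \<phi>(1) by (auto simp: strong_map_def intro: g_map_compose[OF _ T(2)])
    then show ?thesis
      using \<phi>(2) by (intro exI[of _ "\<lambda>y. h (\<phi> y)"]) (auto intro: strong_map_over[OF Y Z])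
  qed
  then show ?thesis
    using Y by (simp add: universal_strong_extension_def)
qed

section \<open>Uniqueness over \<open>X\<close>\<close>

text \<open>Continuity of the inverse comes from compactness of \<open>Y\<close> and the Hausdorff
  property of \<open>Z\<close>.\<close>

lemma g_map_bij_inverse:
  assumes "g_flow Y actY" "g_flow Z actZ" "g_map Y actY Z actZ f"
    and "bij_betw f (topspace Y) (topspace Z)"
  shows "g_map Z actZ Y actY (inv_into (topspace Y) f)"
proof -
  let ?g = "inv_into (topspace Y) f"
  have inj: "inj_on f (topspace Y)" and surj: "f ` topspace Y = topspace Z"
    using assms(4) by (auto simp: bij_betw_def)
  have "homeomorphic_map Y Z f"
    by (rule continuous_imp_homeomorphic_map)
       (use assms(1-3) inj surj in \<open>simp_all add: g_flow_def g_map_def\<close>)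
  then obtain h where h: "homeomorphic_maps Y Z f h"
    unfolding homeomorphic_map_maps by (rule exE)
  have "continuous_map Z Y ?g"
  proof (rule continuous_map_eq[rotated])
    show "continuous_map Z Y h"
      using h by (simp add: homeomorphic_maps_def)
    show "h z = ?g z" if "z \<in> topspace Z" for z
    proof -
      have "h z \<in> topspace Y" "f (h z) = z"
        using h that by (auto simp: homeomorphic_maps_def continuous_map_def)
      then show ?thesis
        using inj inv_into_f_eq by metis
    qed
  qed
  moreover have "?g (actZ z g) = actY (?g z) g" if "z \<in> topspace Z" for z g
  proof -
    have y: "?g z \<in> topspace Y" "f (?g z) = z"
      using that surj by (auto simp: inv_into_into f_inv_into_f)
    then have "actZ z g = f (actY (?g z) g)"
      using assms(3) by (simp add: g_map_def)
    then show ?thesis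
      using inj act_in_topspace[OF assms(1) y(1)] by simp
  qed
  ultimately show ?thesis
    by (simp add: g_map_def)
qed

text \<open>Universality on both sides gives maps \<open>f\<close> and \<open>h\<close> over
  \<open>X\<close> in opposite directions. Following \<open>f\<close> by \<open>h\<close> gives an
  endomorphism of \<open>S\<close> over \<open>X\<close>, hence an injective map, so
  \<open>f\<close> is injective; as a strong map it is onto.\<close>

lemma coalescent_universal_bij:
  assumes X: "g_flow X actX"
    and S: "universal_strong_extension TYPE('g::topological_group_add set set) X actX S actS \<psi>S"
    and inj: "\<And>\<phi>. g_map S actS S actS \<phi> \<Longrightarrow> (\<And>s. s \<in> topspace S \<Longrightarrow> \<psi>S (\<phi> s) = \<psi>S s) \<Longrightarrow>
      inj_on \<phi> (topspace S)"
    and Y: "universal_strong_extension TYPE('g set set) X (actX :: 'x \<Rightarrow> 'g \<Rightarrow> 'x) Y actY \<psi>Y"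
  obtains f where "g_map S actS Y actY f" "bij_betw f (topspace S) (topspace Y)"
    "\<And>s. s \<in> topspace S \<Longrightarrow> \<psi>Y (f s) = \<psi>S s"
proof -
  have SX: "strong_extension X actX S actS \<psi>S" and YX: "strong_extension X actX Y actY \<psi>Y"
    using S Y by (auto simp: universal_strong_extension_def)
  obtain f where f: "strong_map S actS Y actY f" "\<And>s. s \<in> topspace S \<Longrightarrow> \<psi>Y (f s) = \<psi>S s"
    using universal_strong_extension_any_type[OF X S] YX
    unfolding universal_strong_extension_def by blast
  obtain h where h: "strong_map Y actY S actS h" "\<And>y. y \<in> topspace Y \<Longrightarrow> \<psi>S (h y) = \<psi>Y y"
    using universal_strong_extension_any_type[OF X Y] SX
    unfolding universal_strong_extension_def by blast
  have fY: "f s \<in> topspace Y" if "s \<in> topspace S" for s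
    using g_map_image_topspace[of S actS Y actY f] f(1) that by (auto simp: strong_map_def)
  have "inj_on (\<lambda>s. h (f s)) (topspace S)"
    using f h fY by (intro inj g_map_compose[of S actS Y actY f S actS h]) (auto simp: strong_map_def)
  then have "inj_on f (topspace S)"
    by (auto simp: inj_on_def)
  moreover have "f ` topspace S = topspace Y"
    using strong_extensionD(1)[OF SX] strong_extensionD(1)[OF YX] f(1) SX
    by (intro strong_map_surj) (auto simp: strong_extension_def pre_ambit_def)
  ultimately show ?thesis
    using that f by (auto simp: bij_betw_def strong_map_def)
qed

text \<open>Both extensions are isomorphic over \<open>X\<close> to the same coalescent
  \<open>S\<close>, and the isomorphism passes through it.\<close>

lemma universal_strong_extensions_isomorphic:
  fixes actX :: "'x \<Rightarrow> 'g::topological_group_add \<Rightarrow> 'x"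
  assumes "pre_ambit X actX"
    and "universal_strong_extension TYPE('g set set) X actX Y actY \<psi>Y"
    and "universal_strong_extension TYPE('g set set) X actX Z actZ \<psi>Z"
  shows "isomorphic_over Y actY \<psi>Y Z actZ \<psi>Z"
proof -
  have X: "g_flow X actX"
    using assms(1) by (simp add: pre_ambit_def)
  obtain S :: "'g set set topology" and actS \<psi>S where
    S: "universal_strong_extension TYPE('g set set) X actX S actS \<psi>S"
    and inj: "\<And>\<phi>. g_map S actS S actS \<phi> \<Longrightarrow> (\<And>s. s \<in> topspace S \<Longrightarrow> \<psi>S (\<phi> s) = \<psi>S s) \<Longrightarrow>
      inj_on \<phi> (topspace S)"
    using coalescent_universal_strong_extension[OF assms(1)] by metis
  have flow: "g_flow S actS" "g_flow Y actY" "g_flow Z actZ"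
    using S assms(2,3)
    by (auto simp: universal_strong_extension_def strong_extension_def pre_ambit_def)
  obtain f where f: "g_map S actS Y actY f" "bij_betw f (topspace S) (topspace Y)"
    "\<And>s. s \<in> topspace S \<Longrightarrow> \<psi>Y (f s) = \<psi>S s"
    using coalescent_universal_bij[OF X S inj assms(2)] by metis
  obtain h where h: "g_map S actS Z actZ h" "bij_betw h (topspace S) (topspace Z)"
    "\<And>s. s \<in> topspace S \<Longrightarrow> \<psi>Z (h s) = \<psi>S s"
    using coalescent_universal_bij[OF X S inj assms(3)] by metis
  let ?k = "inv_into (topspace S) f"
  have k: "?k y \<in> topspace S" "f (?k y) = y" if "y \<in> topspace Y" for y
    using f(2) that by (auto simp: bij_betw_def inv_into_into f_inv_into_f)
  have g: "g_map Y actY Z actZ (\<lambda>y. h (?k y))"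
    by (rule g_map_compose[OF g_map_bij_inverse[OF flow(1,2) f(1,2)] h(1)])
  have "bij_betw (h \<circ> ?k) (topspace Y) (topspace Z)"
    using bij_betw_inv_into[OF f(2)] h(2) by (rule bij_betw_trans)
  then have "homeomorphic_map Y Z (\<lambda>y. h (?k y))"
    using flow g by (intro continuous_imp_homeomorphic_map)
      (auto simp: g_flow_def g_map_def bij_betw_def o_def)
  moreover have "\<psi>Z (h (?k y)) = \<psi>Y y" if "y \<in> topspace Y" for y
    using k[OF that] h(3) f(3)[of "?k y"] by simp
  ultimately show ?thesis
    using g unfolding isomorphic_over_def by blast
qed

(* The second conjunct ('y and 'z are arbitrary) says that universality among extensions with
   points in 'g set set is universality among all extensions, so the extension obtained in the
   first conjunct is universal without restriction. *)
theorem theorem3p7: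
  fixes X :: "'x topology"
    and actX :: "'x \<Rightarrow> 'g::{topological_group_add, t2_space} \<Rightarrow> 'x"
  assumes "pre_ambit X actX"
  shows "(\<exists>(S :: 'g set set topology) actS \<psi>.
            universal_strong_extension TYPE('g set set) X actX S actS \<psi>) \<and>
         (\<forall>(Y :: 'y topology) actY \<psi>.
            universal_strong_extension TYPE('g set set) X actX Y actY \<psi> \<longrightarrow>
            universal_strong_extension TYPE('z) X actX Y actY \<psi>) \<and>
         (\<forall>(Y0 :: 'y topology) actY0 \<psi>0 (Y1 :: 'z topology) actY1 \<psi>1.
            universal_strong_extension TYPE('g set set) X actX Y0 actY0 \<psi>0 \<longrightarrow>
            universal_strong_extension TYPE('g set set) X actX Y1 actY1 \<psi>1 \<longrightarrow>
            isomorphic_over Y0 actY0 \<psi>0 Y1 actY1 \<psi>1)"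
proof -
  have X: "g_flow X actX"
    using assms by (simp add: pre_ambit_def)
  obtain S :: "'g set set topology" and actS \<psi> where
    "universal_strong_extension TYPE('g set set) X actX S actS \<psi>"
    using coalescent_universal_strong_extension[OF assms] by metis
  then show ?thesis
    using universal_strong_extension_any_type[OF X] universal_strong_extensions_isomorphic[OF assms]
    by blast
qed

end
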